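(* Let $E$ be the elliptic curve $y^2=x^3+(ax+b)^2$ with $a,b\in\mathbb{Z}$, $b>0$, $4a^3\neq 27b$, and such that writing $b=b_1b_3^3$ with $b_1$ cubefree we have $\gcd(a,b_3)=1$. Let $\alpha:E(\mathbb{Q})\to\mathbb{Q}^*/{\mathbb{Q}^*}^3$ be defined by $\alpha(O)=1$, $\alpha((0,b))=1/(2b)$, and $\alpha((x,y))=y-(ax+b)$ (modulo cubes) for all other points. (1) A class $\bar u\in\mathbb{Q}^*/{\mathbb{Q}^*}^3$ belongs to the image of $\alpha$ if and only if for some (equivalently, for any) representative $u\in\mathbb{Q}^*$ the homogeneous cubic equation $$uX^3+(1/u)Y^3+2bZ^3-2aXYZ=0$$ has a nontrivial integer (equivalently, rational) solution. (2) More precisely: for $u=1$ it has the solution $(X,Y,Z)=(1,-1,0)$; for $u=1/(2b)$ it has the solution $(0,1,-1)$; and if $(x,y)\in E(\mathbb{Q})$ and $z\in\mathbb{Q}^*$ satisfy $y-(ax+b)=uz^3$, it has the solution $(X,Y,Z)=(z^2,-x,z)$. Conversely, if $(X,Y,Z)$ is a solution with $Z\neq0$, then $(x,y)=\big(-XY/Z^2,\ (uX^3-(1/u)Y^3)/(2Z^3)\big)$ is a point of $E(\mathbb{Q})$ with $y-(ax+b)=u(X/Z)^3$; in particular it is a preimage of $\bar u$ under $\alpha$. (3) If the cubic has a nontrivial rational solution and $u$ is the unique positive cubefree integer representative of $\bar u$, written $u=u_1^2u_2$ with $u_1,u_2$ squarefree and coprime, then $u_1u_2\mid 2b$, and the solubility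 of the cubic is equivalent to that of $$u_1X^3+u_2Y^3+\frac{2b}{u_1u_2}Z^3-2aXYZ=0.$$
   Context: $O$ is the point at infinity of $E$. A solution of a homogeneous equation means a nontrivial one (not all variables zero). *)

theory Defs
  imports "HOL-Algebra.Coset" "HOL-Computational_Algebra.Computational_Algebra"
begin

definition cubefree :: "'a :: comm_monoid_mult \<Rightarrow> bool" where
  "cubefree n \<longleftrightarrow> (\<forall>x. x ^ 3 dvd n \<longrightarrow> x dvd 1)"

definition Q_units :: "rat monoid" where
  "Q_units = \<lparr>carrier = {q. q \<noteq> 0}, monoid.mult = (*), one = 1\<rparr>"

definition Q_cubes :: "rat set" where
  "Q_cubes = {q ^ 3 | q. q \<noteq> 0}"

text \<open>The elements of this quotient are cosets, so the representatives of a class are its members.\<close>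

definition Q_mod_cubes :: "rat set monoid" where
  "Q_mod_cubes = Q_units Mod Q_cubes"

definition cube_class :: "rat \<Rightarrow> rat set" where
  "cube_class u = Q_cubes #>\<^bsub>Q_units\<^esub> u"

datatype point = Infinity | Affine rat rat

definition curve_points :: "int \<Rightarrow> int \<Rightarrow> point set" where
  "curve_points a b =
     {Infinity} \<union> {Affine x y | x y. y ^ 2 = x ^ 3 + (of_int a * x + of_int b) ^ 2}"

fun alpha :: "int \<Rightarrow> int \<Rightarrow> point \<Rightarrow> rat set" where
  "alpha a b Infinity = cube_class 1"
| "alpha a b (Affine x y) =
     (if x = 0 \<and> y = of_int b then cube_class (1 / (2 * of_int b))
      else cube_class (y - (of_int a * x + of_int b)))"

definition ternary_cubic :: "rat \<Rightarrow> rat \<Rightarrow> rat \<Rightarrow> rat \<Rightarrow> rat \<times> rat \<times> rat \<Rightarrow> rat" where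
  "ternary_cubic c1 c2 c3 d = (\<lambda>(X, Y, Z). c1 * X ^ 3 + c2 * Y ^ 3 + c3 * Z ^ 3 - d * X * Y * Z)"

definition descent_cubic :: "int \<Rightarrow> int \<Rightarrow> rat \<Rightarrow> rat \<times> rat \<times> rat \<Rightarrow> rat" where
  "descent_cubic a b u = ternary_cubic u (1 / u) (2 * of_int b) (2 * of_int a)"

definition reduced_cubic :: "int \<Rightarrow> int \<Rightarrow> int \<Rightarrow> int \<Rightarrow> rat \<times> rat \<times> rat \<Rightarrow> rat" where
  "reduced_cubic a b u1 u2 =
     ternary_cubic (of_int u1) (of_int u2) (2 * of_int b / (of_int u1 * of_int u2)) (2 * of_int a)"

definition is_solution :: "(rat \<times> rat \<times> rat \<Rightarrow> rat) \<Rightarrow> rat \<times> rat \<times> rat \<Rightarrow> bool" where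
  "is_solution F P \<longleftrightarrow> P \<noteq> (0, 0, 0) \<and> F P = 0"

definition soluble_in :: "rat set \<Rightarrow> (rat \<times> rat \<times> rat \<Rightarrow> rat) \<Rightarrow> bool" where
  "soluble_in S F \<longleftrightarrow> (\<exists>P \<in> S \<times> S \<times> S. is_solution F P)"

abbreviation soluble_rat :: "(rat \<times> rat \<times> rat \<Rightarrow> rat) \<Rightarrow> bool" where
  "soluble_rat \<equiv> soluble_in UNIV"

abbreviation soluble_int :: "(rat \<times> rat \<times> rat \<Rightarrow> rat) \<Rightarrow> bool" where
  "soluble_int \<equiv> soluble_in \<int>"

lemma comm_group_Q_units: "comm_group Q_units"
  by (rule comm_groupI) (auto simp: Q_units_def intro: exI[of _ "inverse _"])

lemma subgroup_Q_cubes: "subgroup Q_cubes Q_units"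
proof -
  interpret comm_group Q_units by (rule comm_group_Q_units)
  show ?thesis
  proof (rule subgroupI)
    fix c assume c: "c \<in> Q_cubes"
    then obtain q where q: "q \<noteq> 0" "c = q ^ 3" by (auto simp: Q_cubes_def)
    have "inv\<^bsub>Q_units\<^esub> c = inverse c"
      by (rule inv_equality) (use q in \<open>auto simp: Q_units_def\<close>)
    with q show "inv\<^bsub>Q_units\<^esub> c \<in> Q_cubes"
      by (auto simp: Q_cubes_def power_inverse intro!: exI[of _ "inverse q"])
  next
    fix c d assume "c \<in> Q_cubes" "d \<in> Q_cubes"
    then obtain q r where "q \<noteq> 0" "c = q ^ 3" "r \<noteq> 0" "d = r ^ 3"
      by (auto simp: Q_cubes_def)
    then show "c \<otimes>\<^bsub>Q_units\<^esub> d \<in> Q_cubes"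
      by (auto simp: Q_cubes_def Q_units_def power_mult_distrib intro!: exI[of _ "q * r"])
  qed (auto simp: Q_units_def Q_cubes_def intro: exI[of _ 1])
qed

lemma cube_class_in_carrier: "u \<noteq> 0 \<Longrightarrow> cube_class u \<in> carrier Q_mod_cubes"
  by (auto simp: Q_mod_cubes_def FactGroup_def RCOSETS_def cube_class_def Q_units_def)

lemma alpha_in_carrier:
  assumes "b > 0" "P \<in> curve_points a b"
  shows "alpha a b P \<in> carrier Q_mod_cubes"
proof (cases P)
  case Infinity
  then show ?thesis by (simp add: cube_class_in_carrier)
next
  case (Affine x y)
  with assms have "y ^ 2 = x ^ 3 + (of_int a * x + of_int b) ^ 2"
    by (auto simp: curve_points_def)
  then have "x = 0 \<and> y = of_int b" if "y - (of_int a * x + of_int b) = 0"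
    using that by auto
  with assms(1) Affine show ?thesis by (auto intro!: cube_class_in_carrier)
qed

end

theory Submission
  imports Defs
begin

text \<open>
  The curve equation reads \<open>(y - (ax + b)) (y + (ax + b)) = x ^ 3\<close>; writing the first factor as
  \<open>u (X/Z) ^ 3\<close> and \<open>x = -XY/Z ^ 2\<close> forces the second to be \<open>-(1/u) (Y/Z) ^ 3\<close>, and the difference of the
  two factors, \<open>2 (ax + b)\<close>, gives the cubic. Solutions with \<open>Z = 0\<close> exist only if \<open>u\<close> is a cube.
  For \<open>u = u1 ^ 2 u2\<close>, substituting \<open>Y = u1 u2 Y'\<close> turns the cubic into \<open>u1 u2\<close> times the reduced one.
  If a prime \<open>p\<close> divides \<open>u1 u2\<close> but not \<open>2b\<close>, then in an integral solution \<open>p\<close> divides \<open>Z\<close>, hence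
  the other two coordinates one after the other, so that no solution is primitive.
\<close>

lemma mem_cube_class_iff: "v \<in> cube_class u \<longleftrightarrow> (\<exists>q. q \<noteq> 0 \<and> v = q ^ 3 * u)"
  by (auto simp: cube_class_def r_coset_def Q_units_def Q_cubes_def)

lemma self_mem_cube_class: "u \<in> cube_class u"
  unfolding mem_cube_class_iff by (intro exI[of _ 1]) simp

lemma cube_class_eqI:
  assumes "v \<in> cube_class u" "u \<noteq> 0"
  shows "cube_class v = cube_class u"
proof -
  interpret comm_group Q_units by (rule comm_group_Q_units)
  show ?thesis
    using repr_independence[of v Q_cubes u] subgroup_Q_cubes assms
    by (simp add: cube_class_def Q_units_def)
qed

lemma cube_class_mult_cube:
  assumes "q \<noteq> 0" "u \<noteq> 0"
  shows "cube_class (q ^ 3 * u) = cube_class u"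
  using assms by (intro cube_class_eqI) (auto simp: mem_cube_class_iff)

lemma carrier_Q_mod_cubes: "carrier Q_mod_cubes = cube_class ` {u. u \<noteq> 0}"
  by (auto simp: Q_mod_cubes_def FactGroup_def RCOSETS_def cube_class_def Q_units_def)

lemma mem_carrier_Q_mod_cubesD:
  assumes "U \<in> carrier Q_mod_cubes" "u \<in> U"
  shows "u \<noteq> 0" and "cube_class u = U"
proof -
  obtain w where representative: "w \<noteq> 0" "U = cube_class w"
    using assms(1) by (auto simp: carrier_Q_mod_cubes)
  with assms(2) show "u \<noteq> 0" by (auto simp: mem_cube_class_iff)
  show "cube_class u = U" using representative assms(2) cube_class_eqI by simp
qed

lemma carrier_Q_mod_cubes_nonempty: "U \<in> carrier Q_mod_cubes \<Longrightarrow> U \<noteq> {}"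
  using self_mem_cube_class by (auto simp: carrier_Q_mod_cubes)

lemma finite_rats_common_denominator:
  fixes A :: "rat set"
  assumes "finite A"
  shows "\<exists>d :: int. d \<noteq> 0 \<and> (\<forall>x\<in>A. of_int d * x \<in> \<int>)"
  using assms
proof induction
  case (insert x A)
  then obtain d :: int where denominator: "d \<noteq> 0" "\<And>y. y \<in> A \<Longrightarrow> of_int d * y \<in> \<int>" by blast
  obtain m n :: int where fraction: "x = of_int m / of_int n" and "n > 0"
    by (cases x) (simp add: Fract_of_int_quotient)
  have "of_int (n * d) * y \<in> \<int>" if "y \<in> insert x A" for y
  proof (cases "y = x")
    case True
    then have "of_int (n * d) * y = of_int (d * m)" using \<open>n > 0\<close> by (simp add: fraction)
    then show ?thesis by (metis Ints_of_int)
  next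
    case False
    with that have "of_int n * (of_int d * y) \<in> \<int>" by (intro Ints_mult[OF Ints_of_int] denominator(2)) simp
    then show ?thesis by (simp add: mult.assoc)
  qed
  with denominator(1) \<open>n > 0\<close> show ?case by (intro exI[of _ "n * d"]) auto
qed (auto intro: exI[of _ 1])

lemma finite_rats_eq_multiple_of_coprime_ints:
  fixes A :: "rat set"
  assumes "finite A" "\<not> A \<subseteq> {0}"
  obtains r and g :: "rat \<Rightarrow> int"
    where "r \<noteq> 0" "\<forall>x\<in>A. x = r * of_int (g x)" "Gcd (g ` A) = 1"
proof -
  obtain d :: int where denominator: "d \<noteq> 0" "\<And>x. x \<in> A \<Longrightarrow> of_int d * x \<in> \<int>"
    using finite_rats_common_denominator[OF assms(1)] by blast
  define h :: "rat \<Rightarrow> int" where "h x = \<lfloor>of_int d * x\<rfloor>" for x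
  have of_int_h: "of_int (h x) = of_int d * x" if "x \<in> A" for x
    using denominator(2)[OF that] by (auto simp: h_def elim: Ints_cases)
  define G where "G = Gcd (h ` A)"
  define g where "g x = h x div G" for x
  have G_mult_g: "G * g x = h x" if "x \<in> A" for x
    using that by (simp add: g_def G_def)
  obtain x where "x \<in> A" "x \<noteq> 0" using assms(2) by blast
  with of_int_h denominator(1) have "h x \<noteq> 0" by force
  with \<open>x \<in> A\<close> have "G \<noteq> 0" by (auto simp: G_def)
  show thesis
  proof
    show "of_int G / of_int d \<noteq> (0 :: rat)" using \<open>G \<noteq> 0\<close> denominator(1) by simp
  next
    have "of_int d * x = of_int G * of_int (g x)" if "x \<in> A" for x
      using of_int_h G_mult_g that by (simp flip: of_int_mult)
    then show "\<forall>x\<in>A. x = of_int G / of_int d * of_int (g x)" using denominator(1) by (simp add: field_simps)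
  next
    have "G = Gcd ((*) G ` g ` A)" using G_mult_g by (simp add: G_def image_image)
    also have "\<dots> = normalize (G * Gcd (g ` A))" by (rule Gcd_mult)
    also have "\<dots> = G * Gcd (g ` A)" by (simp add: G_def normalize_mult)
    finally show "Gcd (g ` A) = 1" using \<open>G \<noteq> 0\<close> by simp
  qed
qed

lemma soluble_rat_iff: "soluble_rat F \<longleftrightarrow> (\<exists>X Y Z. is_solution F (X, Y, Z))"
  by (simp add: soluble_in_def)

lemma ternary_cubic_homogeneous:
  "ternary_cubic c1 c2 c3 d (r * X, r * Y, r * Z) = r ^ 3 * ternary_cubic c1 c2 c3 d (X, Y, Z)"
  by (simp add: ternary_cubic_def power_mult_distrib algebra_simps power3_eq_cube)

lemma soluble_rat_ternary_cubic_primitiveE: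
  assumes "soluble_rat (ternary_cubic c1 c2 c3 d)"
  obtains X Y Z :: int where "Gcd {X, Y, Z} = 1"
    "ternary_cubic c1 c2 c3 d (of_int X, of_int Y, of_int Z) = 0"
proof -
  obtain x y z where nontrivial: "(x, y, z) \<noteq> (0, 0, 0)" and zero: "ternary_cubic c1 c2 c3 d (x, y, z) = 0"
    using assms by (auto simp: soluble_rat_iff is_solution_def)
  have "finite {x, y, z}" "\<not> {x, y, z} \<subseteq> {0}" using nontrivial by auto
  then obtain r and g :: "rat \<Rightarrow> int" where "r \<noteq> 0"
    and multiples: "\<forall>t\<in>{x, y, z}. t = r * of_int (g t)" and coprime: "Gcd (g ` {x, y, z}) = 1"
    by (rule finite_rats_eq_multiple_of_coprime_ints)
  have "(x, y, z) = (r * of_int (g x), r * of_int (g y), r * of_int (g z))"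
    using multiples by blast
  with zero have "r ^ 3 * ternary_cubic c1 c2 c3 d (of_int (g x), of_int (g y), of_int (g z)) = 0"
    by (simp only: ternary_cubic_homogeneous)
  with \<open>r \<noteq> 0\<close> have "ternary_cubic c1 c2 c3 d (of_int (g x), of_int (g y), of_int (g z)) = 0"
    by simp
  with coprime show thesis by (intro that) auto
qed

lemma soluble_int_ternary_cubic_iff:
  "soluble_int (ternary_cubic c1 c2 c3 d) \<longleftrightarrow> soluble_rat (ternary_cubic c1 c2 c3 d)"
proof
  assume "soluble_rat (ternary_cubic c1 c2 c3 d)"
  then obtain X Y Z :: int where "Gcd {X, Y, Z} = 1"
    "ternary_cubic c1 c2 c3 d (of_int X, of_int Y, of_int Z) = 0"
    by (rule soluble_rat_ternary_cubic_primitiveE)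
  then have "is_solution (ternary_cubic c1 c2 c3 d) (of_int X, of_int Y, of_int Z)"
    by (auto simp: is_solution_def)
  then show "soluble_int (ternary_cubic c1 c2 c3 d)"
    unfolding soluble_in_def by (intro bexI) auto
qed (auto simp: soluble_in_def)

lemma soluble_int_descent_cubic_iff:
  "soluble_int (descent_cubic a b u) \<longleftrightarrow> soluble_rat (descent_cubic a b u)"
  unfolding descent_cubic_def by (rule soluble_int_ternary_cubic_iff)

lemma soluble_int_reduced_cubic_iff:
  "soluble_int (reduced_cubic a b u1 u2) \<longleftrightarrow> soluble_rat (reduced_cubic a b u1 u2)"
  unfolding reduced_cubic_def by (rule soluble_int_ternary_cubic_iff)

lemma soluble_rat_ternary_cubic_substitution_iff:
  assumes "k \<noteq> 0" "r \<noteq> 0" "s \<noteq> 0" "t \<noteq> 0"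
  shows "soluble_rat (ternary_cubic (k * r ^ 3 * c1) (k * s ^ 3 * c2) (k * t ^ 3 * c3) (k * r * s * t * d))
    \<longleftrightarrow> soluble_rat (ternary_cubic c1 c2 c3 d)" (is "soluble_rat ?F \<longleftrightarrow> soluble_rat ?G")
proof
  have substituted: "?F (X, Y, Z) = k * ?G (r * X, s * Y, t * Z)" for X Y Z
    by (simp add: ternary_cubic_def power_mult_distrib algebra_simps)
  have solution_iff: "is_solution ?F (X, Y, Z) \<longleftrightarrow> is_solution ?G (r * X, s * Y, t * Z)" for X Y Z
    using assms by (simp add: is_solution_def substituted)
  show "soluble_rat ?G" if "soluble_rat ?F"
    using that by (auto simp: soluble_rat_iff solution_iff)
  assume "soluble_rat ?G"
  then obtain X Y Z where "is_solution ?G (X, Y, Z)" by (auto simp: soluble_rat_iff)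
  then have "is_solution ?F (X / r, Y / s, Z / t)" using assms by (simp add: solution_iff)
  then show "soluble_rat ?F" by (auto simp: soluble_rat_iff)
qed

lemma soluble_descent_cubic_mult_cube_iff:
  assumes "q \<noteq> 0"
  shows "soluble_rat (descent_cubic a b (q ^ 3 * u)) \<longleftrightarrow> soluble_rat (descent_cubic a b u)"
  using soluble_rat_ternary_cubic_substitution_iff[of 1 q "1 / q" 1 u "1 / u" "2 * of_int b" "2 * of_int a"] assms
  by (simp add: descent_cubic_def power_one_over)

lemma soluble_descent_cubic_iff_reduced_cubic:
  assumes "u1 \<noteq> 0" "u2 \<noteq> 0"
  shows "soluble_rat (descent_cubic a b (of_int (u1 ^ 2 * u2))) \<longleftrightarrow>
    soluble_rat (reduced_cubic a b u1 u2)"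
proof -
  define k :: rat where "k = of_int u1 * of_int u2"
  have "k \<noteq> 0" using assms by (simp add: k_def)
  have substitution: "descent_cubic a b (of_int (u1 ^ 2 * u2)) = ternary_cubic (k * 1 ^ 3 * of_int u1)
      (k * (1 / k) ^ 3 * of_int u2) (k * 1 ^ 3 * (2 * of_int b / k)) (k * 1 * (1 / k) * 1 * (2 * of_int a))"
    using assms by (simp add: descent_cubic_def k_def power2_eq_square power3_eq_cube ac_simps)
  show ?thesis
    unfolding substitution reduced_cubic_def k_def[symmetric]
    using \<open>k \<noteq> 0\<close> by (intro soluble_rat_ternary_cubic_substitution_iff) simp_all
qed

lemma Affine_mem_curve_points_iff:
  "Affine x y \<in> curve_points a b \<longleftrightarrow>
    (y - (of_int a * x + of_int b)) * (y + (of_int a * x + of_int b)) = x ^ 3"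
  by (auto simp: curve_points_def power2_eq_square algebra_simps)

lemma is_solution_descent_cubic_1: "is_solution (descent_cubic a b 1) (1, -1, 0)"
  by (simp add: is_solution_def descent_cubic_def ternary_cubic_def)

lemma is_solution_descent_cubic_1_over_2b:
  "is_solution (descent_cubic a b (1 / (2 * of_int b))) (0, 1, -1)"
  by (simp add: is_solution_def descent_cubic_def ternary_cubic_def)

lemma descent_solution_of_point:
  assumes "u \<noteq> 0" "z \<noteq> 0" and point: "Affine x y \<in> curve_points a b"
    and factor: "y - (of_int a * x + of_int b) = u * z ^ 3"
  shows "is_solution (descent_cubic a b u) (z ^ 2, - x, z)"
proof -
  define A where "A = of_int a * x + of_int b"
  have x_cube: "x ^ 3 = u * z ^ 3 * (u * z ^ 3 + 2 * A)"
    using point factor unfolding Affine_mem_curve_points_iff A_def[symmetric]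
    by (simp add: algebra_simps)
  have "descent_cubic a b u (z ^ 2, - x, z) = u * z ^ 3 * z ^ 3 - 1 / u * x ^ 3 + 2 * A * z ^ 3"
    by (simp add: descent_cubic_def ternary_cubic_def A_def algebra_simps power2_eq_square power3_eq_cube)
  also have "\<dots> = 0"
    using assms(1) by (simp add: x_cube algebra_simps)
  finally show ?thesis using assms(2) by (simp add: is_solution_def)
qed

lemma alpha_contains_soluble_descent_cubic:
  assumes "P \<in> curve_points a b"
  shows "\<exists>u\<in>alpha a b P. soluble_rat (descent_cubic a b u)"
proof -
  consider (infinity) "P = Infinity" | (special) "P = Affine 0 (of_int b)"
    | (generic) x y where "P = Affine x y" "\<not> (x = 0 \<and> y = of_int b)"
    by (cases P) auto
  then show ?thesis
  proof cases
    case infinity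
    then have "1 \<in> alpha a b P" by (simp add: self_mem_cube_class)
    then show ?thesis
      using is_solution_descent_cubic_1 unfolding soluble_rat_iff by blast
  next
    case special
    then have "1 / (2 * of_int b) \<in> alpha a b P" by (simp add: self_mem_cube_class)
    then show ?thesis
      using is_solution_descent_cubic_1_over_2b unfolding soluble_rat_iff by blast
  next
    case generic
    define u where "u = y - (of_int a * x + of_int b)"
    have "u \<noteq> 0"
      using assms generic by (auto simp: u_def Affine_mem_curve_points_iff)
    then have "is_solution (descent_cubic a b u) (1 ^ 2, - x, 1)"
      using assms generic by (intro descent_solution_of_point[where y = y]) (auto simp: u_def)
    moreover have "u \<in> alpha a b P"
      unfolding u_def using generic self_mem_cube_class by auto
    ultimately show ?thesis unfolding soluble_rat_iff by blast
  qed
qed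

context
  fixes a b :: int and u X Y Z x y :: rat
  assumes u_nonzero: "u \<noteq> 0" and Z_nonzero: "Z \<noteq> 0"
    and solution: "is_solution (descent_cubic a b u) (X, Y, Z)"
  defines "x \<equiv> - (X * Y) / Z ^ 2" and "y \<equiv> (u * X ^ 3 - (1 / u) * Y ^ 3) / (2 * Z ^ 3)"
begin

lemma descent_solution_factors:
  shows "y - (of_int a * x + of_int b) = u * (X / Z) ^ 3"
    and "y + (of_int a * x + of_int b) = - (1 / u) * (Y / Z) ^ 3"
proof -
  define s where "s = u * (X / Z) ^ 3"
  define t where "t = 1 / u * (Y / Z) ^ 3"
  have "descent_cubic a b u (X, Y, Z) = Z ^ 3 * (s + t + 2 * (of_int a * x + of_int b))"
    using Z_nonzero by (simp add: descent_cubic_def ternary_cubic_def s_def t_def x_def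
        power_divide field_simps power2_eq_square power3_eq_cube)
  then have "2 * (of_int a * x + of_int b) = - s - t"
    using solution Z_nonzero by (simp add: is_solution_def)
  moreover have "2 * y = s - t"
    by (simp add: y_def s_def t_def power_divide diff_divide_distrib)
  ultimately show "y - (of_int a * x + of_int b) = u * (X / Z) ^ 3"
    "y + (of_int a * x + of_int b) = - (1 / u) * (Y / Z) ^ 3"
    by (simp_all add: s_def t_def)
qed

lemma descent_solution_mem_curve_points: "Affine x y \<in> curve_points a b"
  unfolding Affine_mem_curve_points_iff descent_solution_factors
  using u_nonzero by (simp add: x_def power_divide power_mult_distrib flip: power_mult)

lemma alpha_descent_solution:
  assumes "b \<noteq> 0"
  shows "alpha a b (Affine x y) = cube_class u"
proof (cases "X = 0")
  case True
  then have "x = 0" "y = of_int b"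
    using descent_solution_factors(1) by (simp_all add: x_def)
  then have "2 * of_int b * u = (- (Y / Z)) ^ 3"
    using descent_solution_factors(2) u_nonzero by (simp add: field_simps)
  moreover have "u = 2 * of_int b * u * (1 / (2 * of_int b))" using assms by simp
  ultimately have u_eq: "u = (- (Y / Z)) ^ 3 * (1 / (2 * of_int b))" by metis
  with u_nonzero have "- (Y / Z) \<noteq> 0" by auto
  with assms have "cube_class u = cube_class (1 / (2 * of_int b))"
    by (subst u_eq) (intro cube_class_mult_cube; simp)
  then show ?thesis using \<open>x = 0\<close> \<open>y = of_int b\<close> by simp
next
  case False
  then have "\<not> (x = 0 \<and> y = of_int b)"
    using descent_solution_factors(1) u_nonzero Z_nonzero by auto
  then have "alpha a b (Affine x y) = cube_class (y - (of_int a * x + of_int b))" by auto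
  also have "\<dots> = cube_class ((X / Z) ^ 3 * u)"
    unfolding descent_solution_factors(1) by (simp only: mult.commute)
  also have "\<dots> = cube_class u"
    using False u_nonzero Z_nonzero by (intro cube_class_mult_cube) auto
  finally show ?thesis .
qed

end

lemma cube_class_eq_1_of_descent_solution_at_infinity:
  assumes "u \<noteq> 0" "is_solution (descent_cubic a b u) (X, Y, 0)"
  shows "cube_class u = cube_class 1"
proof -
  have cubes: "u ^ 2 * X ^ 3 = - (Y ^ 3)" "X \<noteq> 0" "Y \<noteq> 0"
    using assms by (auto simp: is_solution_def descent_cubic_def ternary_cubic_def
        field_simps power2_eq_square)
  have "(- (u * X / Y)) ^ 3 = - (u * (u ^ 2 * X ^ 3)) / Y ^ 3"
    by (simp add: power_divide power_mult_distrib power2_eq_square power3_eq_cube)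
  then have u_eq: "u = (- (u * X / Y)) ^ 3 * 1" unfolding cubes(1) using cubes(3) by simp
  show ?thesis
    using assms(1) cubes by (subst u_eq) (intro cube_class_mult_cube; simp)
qed

lemma mem_image_alpha_iff:
  assumes "b \<noteq> 0" "U \<in> carrier Q_mod_cubes" "u \<in> U"
  shows "U \<in> alpha a b ` curve_points a b \<longleftrightarrow> soluble_rat (descent_cubic a b u)"
proof
  assume "U \<in> alpha a b ` curve_points a b"
  then obtain v where "v \<in> U" and soluble: "soluble_rat (descent_cubic a b v)"
    using alpha_contains_soluble_descent_cubic by blast
  then have "u \<in> cube_class v"
    using assms mem_carrier_Q_mod_cubesD(2) by simp
  with soluble show "soluble_rat (descent_cubic a b u)"
    by (auto simp: mem_cube_class_iff soluble_descent_cubic_mult_cube_iff)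
next
  assume "soluble_rat (descent_cubic a b u)"
  then obtain X Y Z where solution: "is_solution (descent_cubic a b u) (X, Y, Z)"
    by (auto simp: soluble_rat_iff)
  have representative: "u \<noteq> 0" "U = cube_class u" using assms mem_carrier_Q_mod_cubesD by auto
  show "U \<in> alpha a b ` curve_points a b"
  proof (cases "Z = 0")
    case True
    then have "U = alpha a b Infinity"
      using representative solution cube_class_eq_1_of_descent_solution_at_infinity by simp
    then show ?thesis by (auto simp: curve_points_def)
  next
    case False
    note point = representative(1) False solution
    show ?thesis
      unfolding representative(2) alpha_descent_solution[OF point assms(1), symmetric]
      by (intro imageI descent_solution_mem_curve_points[OF point])
  qed
qed

lemma cubefree_part_exists:
  fixes n :: "'a :: factorial_semiring"
  assumes "n \<noteq> 0"
  shows "\<exists>c k. cubefree c \<and> n = k ^ 3 * c"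
  using assms
proof (induction "size (prime_factorization n)" arbitrary: n rule: less_induct)
  case less
  show ?case
  proof (cases "cubefree n")
    case True
    then show ?thesis by (intro exI[of _ n] exI[of _ 1]) simp
  next
    case False
    then obtain x where nonunit: "\<not> is_unit x" "x ^ 3 dvd n" by (auto simp: cubefree_def)
    then obtain m where factorization: "n = x ^ 3 * m" by (elim dvdE)
    with less.prems have "x \<noteq> 0" "m \<noteq> 0" by auto
    then have "prime_factorization n = prime_factorization (x ^ 3) + prime_factorization m"
      by (simp add: factorization prime_factorization_mult)
    moreover have "prime_factorization (x ^ 3) \<noteq> {#}"
      using nonunit(1) \<open>x \<noteq> 0\<close> by (simp add: prime_factorization_empty_iff is_unit_power_iff)
    ultimately have "size (prime_factorization m) < size (prime_factorization n)"
      by (simp add: nonempty_has_size)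
    with less.hyps \<open>m \<noteq> 0\<close> obtain c k where "cubefree c" "m = k ^ 3 * c" by blast
    then show ?thesis
      by (intro exI[of _ c] exI[of _ "x * k"]) (simp add: factorization power_mult_distrib mult.assoc)
  qed
qed

lemma cubefree_abs_iff: "cubefree \<bar>n :: int\<bar> \<longleftrightarrow> cubefree n"
  by (simp add: cubefree_def)

lemma cubefree_int_representative_unique:
  fixes u v :: int
  assumes "u > 0" "v > 0" "cubefree u" "cubefree v"
    and "(of_int u :: rat) \<in> cube_class (of_int v)"
  shows "u = v"
proof -
  obtain q :: rat where u_eq: "of_int u = q ^ 3 * of_int v"
    using assms(5) by (auto simp: mem_cube_class_iff)
  obtain m n :: int where fraction: "q = of_int m / of_int n" "n > 0" "coprime m n"
    by (cases q) (simp add: Fract_of_int_quotient)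
  have "(of_int (u * n ^ 3) :: rat) = of_int (m ^ 3 * v)"
    using fraction by (simp add: u_eq power_divide)
  then have cleared: "u * n ^ 3 = m ^ 3 * v" by (simp only: of_int_eq_iff)
  have "n ^ 3 dvd m ^ 3 * v" "m ^ 3 dvd u * n ^ 3"
    using cleared by (metis dvd_triv_left dvd_triv_right)+
  moreover have "coprime (m ^ 3) (n ^ 3)" using fraction by simp
  ultimately have "n ^ 3 dvd v" "m ^ 3 dvd u"
    by (simp_all add: coprime_dvd_mult_right_iff coprime_dvd_mult_left_iff coprime_commute)
  then have "is_unit n" "is_unit m" using assms by (auto simp: cubefree_def)
  then have "n = 1" "m = 1 \<or> m = -1" using fraction by auto
  with cleared assms show ?thesis by auto
qed

lemma cubefree_int_representative_exists:
  assumes "w \<noteq> 0"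
  shows "\<exists>u :: int. u > 0 \<and> cubefree u \<and> of_int u \<in> cube_class w"
proof -
  obtain m n :: int where fraction: "w = of_int m / of_int n" "n > 0"
    by (cases w) (simp add: Fract_of_int_quotient)
  with assms have "m * n ^ 2 \<noteq> 0" by auto
  then obtain c k where cubefree_part: "cubefree c" "m * n ^ 2 = k ^ 3 * c"
    using cubefree_part_exists by blast
  with \<open>m * n ^ 2 \<noteq> 0\<close> have nonzero: "c \<noteq> 0" "k \<noteq> 0" by auto
  define q :: rat where "q = of_int n / of_int k"
  have "of_int k ^ 3 * of_int c = (of_int (m * n ^ 2) :: rat)"
    by (simp only: cubefree_part(2) of_int_mult of_int_power)
  also have "\<dots> = of_int n ^ 3 * w"
    using fraction by (simp add: power2_eq_square power3_eq_cube)
  finally have "of_int c = q ^ 3 * w"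
    using nonzero by (simp add: q_def power_divide field_simps)
  moreover have "\<bar>c\<bar> = sgn c ^ 3 * c"
    using nonzero by (cases c "0 :: int" rule: linorder_cases) auto
  ultimately have "of_int \<bar>c\<bar> = (of_int (sgn c) * q) ^ 3 * w"
    by (simp add: power_mult_distrib)
  moreover have "of_int (sgn c) * q \<noteq> 0"
    using nonzero fraction by (simp add: q_def sgn_0_0)
  ultimately have "of_int \<bar>c\<bar> \<in> cube_class w"
    unfolding mem_cube_class_iff by blast
  then show ?thesis
    using cubefree_part(1) nonzero by (intro exI[of _ "\<bar>c\<bar>"]) (auto simp: cubefree_abs_iff)
qed

lemma cubefree_int_representative_ex1:
  assumes "U \<in> carrier Q_mod_cubes"
  shows "\<exists>!u :: int. u > 0 \<and> cubefree u \<and> of_int u \<in> U"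
proof -
  obtain w where "w \<noteq> 0" "U = cube_class w" using assms by (auto simp: carrier_Q_mod_cubes)
  then have "\<exists>u :: int. u > 0 \<and> cubefree u \<and> of_int u \<in> U"
    by (simp add: cubefree_int_representative_exists)
  then show ?thesis
    using cubefree_int_representative_unique mem_carrier_Q_mod_cubesD(2)[OF assms] by blast
qed

lemma cubefree_decomposition:
  fixes u :: "'a :: factorial_semiring"
  assumes "cubefree u"
  shows "\<exists>u1 u2. u = u1 ^ 2 * u2 \<and> squarefree u1 \<and> squarefree u2 \<and> coprime u1 u2"
proof (intro exI conjI)
  let ?s = "square_part u" and ?t = "squarefree_part u"
  show decomposition: "u = ?s ^ 2 * ?t"
    using squarefree_decompose[of u] by (simp add: mult.commute)
  show "squarefree ?t" by simp
  show "squarefree ?s"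
  proof (rule squarefreeI)
    fix x assume "x ^ 2 dvd ?s"
    then have "(x ^ 2) ^ 2 dvd u" by (subst decomposition) (intro dvd_mult2 dvd_power_same)
    then have "x ^ 3 dvd u"
      by (rule dvd_trans[rotated]) (simp add: le_imp_power_dvd flip: power_mult)
    with assms show "is_unit x" by (simp add: cubefree_def)
  qed
  show "coprime ?s ?t"
  proof (rule coprimeI)
    fix x assume "x dvd ?s" "x dvd ?t"
    then have "x ^ 2 * x dvd u" by (subst decomposition) (intro mult_dvd_mono dvd_power_same)
    with assms show "is_unit x" by (simp add: cubefree_def power3_eq_cube power2_eq_square)
  qed
qed

lemma squarefree_dvdI:
  fixes n m :: "'a :: factorial_semiring"
  assumes "squarefree n" "\<And>p. prime p \<Longrightarrow> p dvd n \<Longrightarrow> p dvd m"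
  shows "n dvd m"
proof (cases "m = 0")
  case False
  have "n \<noteq> 0" using assms(1) by auto
  show ?thesis
  proof (rule multiplicity_le_imp_dvd[OF \<open>n \<noteq> 0\<close>])
    fix p :: 'a assume "prime p"
    show "multiplicity p n \<le> multiplicity p m"
    proof (cases "p dvd n")
      case True
      have "multiplicity p n \<le> 1"
        using assms(1) \<open>n \<noteq> 0\<close> \<open>prime p\<close> by (simp add: squarefree_factorial_semiring'')
      also have "1 \<le> multiplicity p m"
        using assms(2)[OF \<open>prime p\<close> True] False \<open>prime p\<close> by (intro multiplicity_geI) auto
      finally show ?thesis .
    qed (simp add: not_dvd_imp_multiplicity_0)
  qed
qed simp

text \<open>
  The three pure terms have pairwise distinct \<open>p\<close>-adic valuations modulo \<open>3\<close> as long as \<open>p\<close> divides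
  none of the coefficients.
\<close>

lemma prime_elem_dvd_ternary_cubic_solution:
  fixes p A B C D X Y Z :: "'a :: idom"
  assumes prime: "prime_elem p"
    and coefficients: "\<not> p dvd A" "\<not> p dvd B" "\<not> p dvd C"
    and cubic: "p ^ 2 * A * X ^ 3 + p * B * Y ^ 3 + C * Z ^ 3 = p * D * X * Y * Z"
  shows "p dvd X" "p dvd Y" "p dvd Z"
proof -
  have "p \<noteq> 0" using prime by auto
  have dvd_of_mult_cube: "p dvd t" if "p dvd c * t ^ 3" "\<not> p dvd c" for c t
    using that prime prime_elem_dvd_multD prime_elem_dvd_power by blast
  have "C * Z ^ 3 = p * (D * X * Y * Z - p * A * X ^ 3 - B * Y ^ 3)"
    using cubic by (simp add: algebra_simps power2_eq_square)
  then show "p dvd Z" by (rule dvd_of_mult_cube[OF dvdI coefficients(3)])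
  then obtain Z' where Z_eq: "Z = p * Z'" by blast
  have "p * (B * Y ^ 3) = p * (p * (D * X * Y * Z' - A * X ^ 3 - p * C * Z' ^ 3))"
    using cubic by (simp add: Z_eq algebra_simps power2_eq_square power3_eq_cube)
  with \<open>p \<noteq> 0\<close> have "B * Y ^ 3 = p * (D * X * Y * Z' - A * X ^ 3 - p * C * Z' ^ 3)" by simp
  then show "p dvd Y" by (rule dvd_of_mult_cube[OF dvdI coefficients(2)])
  then obtain Y' where Y_eq: "Y = p * Y'" by blast
  have "p ^ 2 * (A * X ^ 3) = p ^ 2 * (p * (D * X * Y' * Z' - p * B * Y' ^ 3 - C * Z' ^ 3))"
    using cubic by (simp add: Z_eq Y_eq algebra_simps power2_eq_square power3_eq_cube)
  with \<open>p \<noteq> 0\<close> have "A * X ^ 3 = p * (D * X * Y' * Z' - p * B * Y' ^ 3 - C * Z' ^ 3)" by simp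
  then show "p dvd X" by (rule dvd_of_mult_cube[OF dvdI coefficients(1)])
qed

lemma prime_dvd_of_primitive_solution:
  fixes p v w c d X Y Z :: int
  assumes "prime p" and exact: "p dvd v" "\<not> p ^ 2 dvd v" and "\<not> p dvd w"
    and cubic: "v ^ 2 * w * X ^ 3 + v * w ^ 2 * Y ^ 3 + c * Z ^ 3 = d * v * w * X * Y * Z"
    and primitive: "Gcd {X, Y, Z} = 1"
  shows "p dvd c"
proof (rule ccontr)
  assume "\<not> p dvd c"
  obtain v' where v_eq: "v = p * v'" using exact(1) by blast
  then have "\<not> p dvd v'" using exact(2) by (auto simp: power2_eq_square)
  have coefficients: "\<not> p dvd v' ^ 2 * w" "\<not> p dvd v' * w ^ 2"
    using \<open>prime p\<close> \<open>\<not> p dvd v'\<close> \<open>\<not> p dvd w\<close>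
    by (auto simp: prime_dvd_mult_iff dest: prime_dvd_power)
  have "p ^ 2 * (v' ^ 2 * w) * X ^ 3 + p * (v' * w ^ 2) * Y ^ 3 + c * Z ^ 3 =
      p * (d * v' * w) * X * Y * Z"
    using cubic by (simp add: v_eq power_mult_distrib ac_simps)
  from prime_elem_dvd_ternary_cubic_solution[OF prime_imp_prime_elem[OF \<open>prime p\<close>]
      coefficients \<open>\<not> p dvd c\<close> this]
  have "p dvd Gcd {X, Y, Z}" by simp
  with primitive \<open>prime p\<close> show False by auto
qed

lemma reduced_cubic_of_int_eq_0_iff:
  assumes "u1 \<noteq> 0" "u2 \<noteq> 0"
  shows "reduced_cubic a b u1 u2 (of_int X, of_int Y, of_int Z) = 0 \<longleftrightarrow>
    u1 ^ 2 * u2 * X ^ 3 + u1 * u2 ^ 2 * Y ^ 3 + 2 * b * Z ^ 3 = 2 * a * u1 * u2 * X * Y * Z"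
    (is "_ \<longleftrightarrow> ?l = ?r")
proof -
  have "of_int (u1 * u2) * reduced_cubic a b u1 u2 (of_int X, of_int Y, of_int Z) = of_int (?l - ?r)"
    using assms by (simp add: reduced_cubic_def ternary_cubic_def field_simps power2_eq_square)
  then have "reduced_cubic a b u1 u2 (of_int X, of_int Y, of_int Z) = 0 \<longleftrightarrow> (of_int (?l - ?r) :: rat) = 0"
    using assms by (metis mult_eq_0_iff of_int_eq_0_iff)
  then show ?thesis by (simp only: of_int_eq_0_iff right_minus_eq)
qed

lemma soluble_reduced_cubic_imp_dvd:
  assumes factors: "squarefree u1" "squarefree u2" "coprime u1 u2"
    and soluble: "soluble_rat (reduced_cubic a b u1 u2)"
  shows "u1 * u2 dvd 2 * b"
proof (rule squarefree_dvdI)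
  show "squarefree (u1 * u2)" using factors by (simp add: squarefree_mult_coprime)
  obtain X Y Z :: int where primitive: "Gcd {X, Y, Z} = 1"
    and zero: "reduced_cubic a b u1 u2 (of_int X, of_int Y, of_int Z) = 0"
    using soluble unfolding reduced_cubic_def by (rule soluble_rat_ternary_cubic_primitiveE)
  have nonzero: "u1 \<noteq> 0" "u2 \<noteq> 0" using factors by auto
  have cubic: "u1 ^ 2 * u2 * X ^ 3 + u1 * u2 ^ 2 * Y ^ 3 + 2 * b * Z ^ 3 = 2 * a * u1 * u2 * X * Y * Z"
    using zero reduced_cubic_of_int_eq_0_iff[OF nonzero] by blast
  then have cubic_swapped:
    "u2 ^ 2 * u1 * Y ^ 3 + u2 * u1 ^ 2 * X ^ 3 + 2 * b * Z ^ 3 = 2 * a * u2 * u1 * Y * X * Z"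
    by (simp add: ac_simps)
  have primitive_swapped: "Gcd {Y, X, Z} = 1" using primitive by (simp only: insert_commute)
  fix p :: int assume prime_divisor: "prime p" "p dvd u1 * u2"
  have no_square: "\<not> p ^ 2 dvd u1" "\<not> p ^ 2 dvd u2"
    using factors prime_divisor(1) by (auto simp: squarefree_def)
  have "\<not> (p dvd u1 \<and> p dvd u2)"
    using factors(3) prime_divisor(1) by (meson not_coprimeI not_prime_unit)
  moreover have "p dvd u1 \<or> p dvd u2" using prime_divisor by (simp add: prime_dvd_mult_iff)
  ultimately show "p dvd 2 * b"
    using prime_dvd_of_primitive_solution[OF prime_divisor(1) _ no_square(1) _ cubic primitive]
      prime_dvd_of_primitive_solution[OF prime_divisor(1) _ no_square(2) _ cubic_swapped primitive_swapped]
    by blast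
qed

theorem theorem3p1:
  fixes a b b1 b3 :: int
  assumes b_pos: "b > 0"
    and nonsingular: "4 * a ^ 3 \<noteq> 27 * b"
    and b_decomp: "b = b1 * b3 ^ 3" "cubefree b1"
    and gcd_cond: "gcd a b3 = 1"
  shows
    "(\<forall>U \<in> carrier Q_mod_cubes.
        (U \<in> alpha a b ` curve_points a b \<longleftrightarrow> (\<exists>u\<in>U. soluble_int (descent_cubic a b u))) \<and>
        (U \<in> alpha a b ` curve_points a b \<longleftrightarrow> (\<forall>u\<in>U. soluble_int (descent_cubic a b u))) \<and>
        (U \<in> alpha a b ` curve_points a b \<longleftrightarrow> (\<exists>u\<in>U. soluble_rat (descent_cubic a b u))) \<and>
        (U \<in> alpha a b ` curve_points a b \<longleftrightarrow> (\<forall>u\<in>U. soluble_rat (descent_cubic a b u)))) \<and>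
     (is_solution (descent_cubic a b 1) (1, -1, 0) \<and>
      is_solution (descent_cubic a b (1 / (2 * of_int b))) (0, 1, -1) \<and>
      (\<forall>u x y z :: rat. u \<noteq> 0 \<and> z \<noteq> 0 \<and> Affine x y \<in> curve_points a b \<and>
          y - (of_int a * x + of_int b) = u * z ^ 3 \<longrightarrow>
          is_solution (descent_cubic a b u) (z ^ 2, - x, z)) \<and>
      (\<forall>u X Y Z :: rat. u \<noteq> 0 \<and> Z \<noteq> 0 \<and> is_solution (descent_cubic a b u) (X, Y, Z) \<longrightarrow>
          (let x = - (X * Y) / Z ^ 2; y = (u * X ^ 3 - (1 / u) * Y ^ 3) / (2 * Z ^ 3) in
             Affine x y \<in> curve_points a b \<and>
             y - (of_int a * x + of_int b) = u * (X / Z) ^ 3 \<and>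
             alpha a b (Affine x y) = cube_class u))) \<and>
     (\<forall>U \<in> carrier Q_mod_cubes.
        (\<exists>!u :: int. u > 0 \<and> cubefree u \<and> of_int u \<in> U) \<and>
        (\<forall>u :: int. u > 0 \<and> cubefree u \<and> of_int u \<in> U \<longrightarrow>
           (\<exists>u1 u2 :: int. u = u1 ^ 2 * u2 \<and> squarefree u1 \<and> squarefree u2 \<and> coprime u1 u2) \<and>
           (\<forall>u1 u2 :: int. u = u1 ^ 2 * u2 \<and> squarefree u1 \<and> squarefree u2 \<and> coprime u1 u2 \<longrightarrow>
              (soluble_rat (descent_cubic a b (of_int u)) \<longrightarrow> u1 * u2 dvd 2 * b) \<and>
              (soluble_rat (descent_cubic a b (of_int u)) \<longleftrightarrow> soluble_rat (reduced_cubic a b u1 u2)) \<and>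
              (soluble_int (descent_cubic a b (of_int u)) \<longleftrightarrow> soluble_int (reduced_cubic a b u1 u2)))))"
proof (unfold Let_def, intro conjI ballI allI impI)
  fix U assume U: "U \<in> carrier Q_mod_cubes"
  note image_iff = mem_image_alpha_iff[OF dual_order.strict_implies_not_eq[OF b_pos] U]
  show "U \<in> alpha a b ` curve_points a b \<longleftrightarrow> (\<exists>u\<in>U. soluble_int (descent_cubic a b u))"
    "U \<in> alpha a b ` curve_points a b \<longleftrightarrow> (\<forall>u\<in>U. soluble_int (descent_cubic a b u))"
    "U \<in> alpha a b ` curve_points a b \<longleftrightarrow> (\<exists>u\<in>U. soluble_rat (descent_cubic a b u))"
    "U \<in> alpha a b ` curve_points a b \<longleftrightarrow> (\<forall>u\<in>U. soluble_rat (descent_cubic a b u))"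
    unfolding soluble_int_descent_cubic_iff
    using image_iff carrier_Q_mod_cubes_nonempty[OF U] by blast+
  show "\<exists>!u :: int. u > 0 \<and> cubefree u \<and> of_int u \<in> U"
    by (rule cubefree_int_representative_ex1[OF U])
next
  fix u u1 u2 :: int
  assume decomposition: "u = u1 ^ 2 * u2 \<and> squarefree u1 \<and> squarefree u2 \<and> coprime u1 u2"
  then show soluble_iff:
    "soluble_rat (descent_cubic a b (of_int u)) \<longleftrightarrow> soluble_rat (reduced_cubic a b u1 u2)"
    by (metis soluble_descent_cubic_iff_reduced_cubic not_squarefree_0)
  then show "soluble_int (descent_cubic a b (of_int u)) \<longleftrightarrow> soluble_int (reduced_cubic a b u1 u2)"
    by (simp only: soluble_int_descent_cubic_iff soluble_int_reduced_cubic_iff)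
  show "u1 * u2 dvd 2 * b" if "soluble_rat (descent_cubic a b (of_int u))"
    using that soluble_iff soluble_reduced_cubic_imp_dvd decomposition by blast
qed ((elim conjE)?; rule is_solution_descent_cubic_1 is_solution_descent_cubic_1_over_2b
    descent_solution_of_point descent_solution_mem_curve_points descent_solution_factors(1)
    alpha_descent_solution cubefree_decomposition; (assumption | use b_pos in simp))+

end
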